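(* There exists a $q$-$\Delta$-matroid that is not a weak $q$-$g$-matroid (and hence is not a $q$-$g$-matroid either). That is, there exist a field $\mathbb{F}$, an integer $n$, and a family $\mathcal{F}$ of subspaces of $E=\mathbb{F}^n$ such that $(E,\mathcal{F})$ is a $q$-$\Delta$-matroid but neither a weak $q$-$g$-matroid nor a $q$-$g$-matroid.
   Context: Let $E$ be a finite-dimensional vector space over a field. A $q$-matroid on $E$ is a pair $M=(E,r)$ with $r$ an integer-valued function on the subspaces of $E$ such that (R1) $0\le r(A)\le\dim A$ for every subspace $A$; (R2) $r(A)\le r(B)$ whenever $A\subseteq B$; (R3) $r(A+B)+r(A\cap B)\le r(A)+r(B)$ for all subspaces $A,B$. A subspace $A$ is independent if $r(A)=\dim A$; a basis is an inclusion-maximal independent subspace; $A$ is spanning if $r(A)=r(E)$; $A$ is a flat if $r(A+x)>r(A)$ for every $1$-dimensional subspace $x\not\subseteq A$. For $q$-matroids $M_1,M_2$ on the same ground space $E$, the identity $Id:M_1\to M_2$ is a strong map if every flat of $M_2$ is a flat of $M_1$. A $q$-$g$-matroid is a pair $(E,\mathcal{F})$ for which there exist $q$-matroids $M_1,M_2$ on $E$ such that $Id:M_1\to M_2$ is a strong map and $\mathcal{F}$ is the set of all subspaces of $E$ that are independent in $M_1$ and spanning in $M_2$. A weak $q$-$g$-matroid is a pair $(E,\mathcal{F})$ for which there exist $q$-matroids $M_1,M_2$ on $E$ such that every basis of $M_2$ is contained in a basis of $M_1$, every basis of $M_1$ contains a basis of $M_2$, and $\mathcal{F}$ is the set of all subspaces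 $F\subseteq E$ for which there exist a basis $B_2$ of $M_2$ and a basis $B_1$ of $M_1$ with $B_2\subseteq F\subseteq B_1$. A $q$-$\Delta$-matroid is a pair $(E,\mathcal{F})$ with $\mathcal{F}$ a non-empty family of subspaces of $E$ satisfying: (F1) For all $X,Y\in\mathcal{F}$ and each subspace $A$ of codimension $1$ in $X$, either (i) there is a codimension-$1$ subspace $Z\subseteq E$ with $A\subseteq Z$, $Y\not\subseteq Z$, such that $A+z\in\mathcal{F}$ for all $1$-dimensional $z\subseteq E$ with $z\not\subseteq Z$; or (ii) there is a codimension-$1$ subspace $Z\subseteq E$ such that $Z\cap A\in\mathcal{F}$. (F2) For all $X,Y\in\mathcal{F}$ and each subspace $A\subseteq E$ in which $X$ has codimension $1$, either (iii) there is a $1$-dimensional $z\subseteq A$, $z\not\subseteq Y$, such that $A\cap Z\in\mathcal{F}$ for every codimension-$1$ subspace $Z\subseteq E$ with $z\not\subseteq Z$; or (iv) there is a $1$-dimensional $z\subseteq E$ such that $A+z\in\mathcal{F}$. *)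

theory Defs
  imports "Jordan_Normal_Form.Missing_VectorSpace"
begin

locale fin_dim_vectorspace = vectorspace K V for K and V (structure) +
  assumes fin_dim: "fin_dim"
begin

abbreviation sub :: "'c set \<Rightarrow> bool" where
  "sub A \<equiv> subspace K A V"

definition sdim :: "'c set \<Rightarrow> nat" where
  "sdim A = vectorspace.dim K (vs A)"

definition line :: "'c set \<Rightarrow> bool" where
  "line x \<longleftrightarrow> sub x \<and> sdim x = 1"

definition codim1 :: "'c set \<Rightarrow> 'c set \<Rightarrow> bool" where
  "codim1 A X \<longleftrightarrow> sub A \<and> sub X \<and> A \<subseteq> X \<and> sdim X = sdim A + 1"

(* A q-matroid is represented by its rank function; the values of r on sets that are not
   subspaces are unconstrained and never used. *)
definition q_matroid :: "('c set \<Rightarrow> int) \<Rightarrow> bool" where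
  "q_matroid r \<longleftrightarrow>
     (\<forall>A. sub A \<longrightarrow> 0 \<le> r A \<and> r A \<le> int (sdim A)) \<and>
     (\<forall>A B. sub A \<and> sub B \<and> A \<subseteq> B \<longrightarrow> r A \<le> r B) \<and>
     (\<forall>A B. sub A \<and> sub B \<longrightarrow> r (subspace_sum A B) + r (A \<inter> B) \<le> r A + r B)"

definition q_independent :: "('c set \<Rightarrow> int) \<Rightarrow> 'c set \<Rightarrow> bool" where
  "q_independent r A \<longleftrightarrow> sub A \<and> r A = int (sdim A)"

definition q_basis :: "('c set \<Rightarrow> int) \<Rightarrow> 'c set \<Rightarrow> bool" where
  "q_basis r B \<longleftrightarrow> maximal B (q_independent r)"

definition q_spanning :: "('c set \<Rightarrow> int) \<Rightarrow> 'c set \<Rightarrow> bool" where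
  "q_spanning r A \<longleftrightarrow> sub A \<and> r A = r (carrier V)"

definition q_flat :: "('c set \<Rightarrow> int) \<Rightarrow> 'c set \<Rightarrow> bool" where
  "q_flat r A \<longleftrightarrow> sub A \<and> (\<forall>x. line x \<and> \<not> x \<subseteq> A \<longrightarrow> r (subspace_sum A x) > r A)"

definition id_strong_map :: "('c set \<Rightarrow> int) \<Rightarrow> ('c set \<Rightarrow> int) \<Rightarrow> bool" where
  "id_strong_map r1 r2 \<longleftrightarrow> (\<forall>A. q_flat r2 A \<longrightarrow> q_flat r1 A)"

definition q_g_matroid :: "'c set set \<Rightarrow> bool" where
  "q_g_matroid \<F> \<longleftrightarrow>
     (\<exists>r1 r2. q_matroid r1 \<and> q_matroid r2 \<and> id_strong_map r1 r2 \<and>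
        \<F> = {A. sub A \<and> q_independent r1 A \<and> q_spanning r2 A})"

definition weak_q_g_matroid :: "'c set set \<Rightarrow> bool" where
  "weak_q_g_matroid \<F> \<longleftrightarrow>
     (\<exists>r1 r2. q_matroid r1 \<and> q_matroid r2 \<and>
        (\<forall>B2. q_basis r2 B2 \<longrightarrow> (\<exists>B1. q_basis r1 B1 \<and> B2 \<subseteq> B1)) \<and>
        (\<forall>B1. q_basis r1 B1 \<longrightarrow> (\<exists>B2. q_basis r2 B2 \<and> B2 \<subseteq> B1)) \<and>
        \<F> = {A. sub A \<and> (\<exists>B2 B1. q_basis r2 B2 \<and> q_basis r1 B1 \<and> B2 \<subseteq> A \<and> A \<subseteq> B1)})"

definition F1 :: "'c set set \<Rightarrow> bool" where
  "F1 \<F> \<longleftrightarrow>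
     (\<forall>X\<in>\<F>. \<forall>Y\<in>\<F>. \<forall>A. codim1 A X \<longrightarrow>
        (\<exists>Z. codim1 Z (carrier V) \<and> A \<subseteq> Z \<and> \<not> Y \<subseteq> Z \<and>
           (\<forall>z. line z \<and> \<not> z \<subseteq> Z \<longrightarrow> subspace_sum A z \<in> \<F>)) \<or>
        (\<exists>Z. codim1 Z (carrier V) \<and> Z \<inter> A \<in> \<F>))"

definition F2 :: "'c set set \<Rightarrow> bool" where
  "F2 \<F> \<longleftrightarrow>
     (\<forall>X\<in>\<F>. \<forall>Y\<in>\<F>. \<forall>A. codim1 X A \<longrightarrow>
        (\<exists>z. line z \<and> z \<subseteq> A \<and> \<not> z \<subseteq> Y \<and>
           (\<forall>Z. codim1 Z (carrier V) \<and> \<not> z \<subseteq> Z \<longrightarrow> A \<inter> Z \<in> \<F>)) \<or>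
        (\<exists>z. line z \<and> subspace_sum A z \<in> \<F>))"

definition q_delta_matroid :: "'c set set \<Rightarrow> bool" where
  "q_delta_matroid \<F> \<longleftrightarrow> \<F> \<noteq> {} \<and> (\<forall>X\<in>\<F>. sub X) \<and> F1 \<F> \<and> F2 \<F>"

end

(* HOL cannot quantify over types, so "there is a field" is expressed by quantifying over ring
   records. Records over int cover, up to isomorphism, every countable field, in particular
   all finite ones; an existence claim over them implies the claim over all fields. *)
abbreviation coord_space :: "('a, 'm) ring_scheme \<Rightarrow> nat \<Rightarrow> ('a, nat \<Rightarrow> 'a) module" where
  "coord_space K n \<equiv> ring.func_space K {..<n}"

(* The standing assumption of the locale holds for the coordinate spaces. *)
lemma fin_dim_vectorspace_coord_space:
  fixes K (structure)
  assumes "field K"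
  shows "fin_dim_vectorspace K (coord_space K n)"
proof -
  interpret K: field K by fact
  define V where "V = coord_space K n"
  interpret V: module K V unfolding V_def by (rule K.func_space_is_module)
  interpret V: vectorspace K V by unfold_locales
  define e where "e i = (\<lambda>j\<in>{..<n}. if j = i then \<one> else \<zero>)" for i
  have carr: "carrier V = {..<n} \<rightarrow>\<^sub>E carrier K"
    and add: "f \<oplus>\<^bsub>V\<^esub> g = (\<lambda>j\<in>{..<n}. f j \<oplus> g j)"
    and zero: "\<zero>\<^bsub>V\<^esub> = (\<lambda>j\<in>{..<n}. \<zero>)"
    and smult: "c \<odot>\<^bsub>V\<^esub> f = (\<lambda>j\<in>{..<n}. c \<otimes> f j)" for f g c
    by (simp_all add: V_def K.func_space_def)
  have e_carr: "e i \<in> carrier V" for i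
    by (auto simp: carr e_def)
  have inj: "inj_on e {..<n}"
  proof (rule inj_onI)
    fix i j assume ij: "i \<in> {..<n}" "j \<in> {..<n}" "e i = e j"
    from ij(3) have "e i i = e j i" by simp
    with ij(1) show "i = j" unfolding e_def by (simp split: if_splits)
  qed
  have pointwise: "(\<Oplus>\<^bsub>V\<^esub>i\<in>I. f i) j = (\<Oplus>i\<in>I. f i j)"
    if "finite I" "f \<in> I \<rightarrow> carrier V" "j < n" for I :: "nat set" and f j
    using that
  proof (induction I rule: finite_induct)
    case empty
    then show ?case by (simp add: zero)
  next
    case (insert i I)
    have "f i j \<in> carrier K" "(\<lambda>i. f i j) \<in> I \<rightarrow> carrier K"
      using insert.prems by (auto simp: carr Pi_iff PiE_iff)
    then show ?case using insert by (simp add: V.finsum_insert K.finsum_insert add Pi_iff)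
  qed
  have "V.gen_set (e ` {..<n})"
  proof
    show "V.span (e ` {..<n}) \<subseteq> carrier V"
      using e_carr by (intro V.span_is_subset2) auto
    show "carrier V \<subseteq> V.span (e ` {..<n})"
    proof
      fix v assume v: "v \<in> carrier V"
      define a where "a w = v (the_inv_into {..<n} e w)" for w
      have a_e: "a (e i) = v i" if "i < n" for i
        using that by (simp add: a_def the_inv_into_f_f[OF inj])
      have v_carr: "v i \<in> carrier K" if "i < n" for i
        using v that by (auto simp: carr)
      have a: "a \<in> e ` {..<n} \<rightarrow> carrier K"
        by (auto simp: a_e v_carr)
      have ve: "(\<lambda>i. v i \<odot>\<^bsub>V\<^esub> e i) \<in> {..<n} \<rightarrow> carrier V"
        using v_carr e_carr by auto
      have "V.lincomb a (e ` {..<n}) = (\<Oplus>\<^bsub>V\<^esub>i\<in>{..<n}. a (e i) \<odot>\<^bsub>V\<^esub> e i)"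
        unfolding V.lincomb_def
        using a e_carr by (intro V.finsum_reindex inj) (auto simp: Pi_iff)
      also have "\<dots> = (\<Oplus>\<^bsub>V\<^esub>i\<in>{..<n}. v i \<odot>\<^bsub>V\<^esub> e i)"
        using ve by (intro V.finsum_cong') (auto simp: a_e)
      also have "\<dots> = v"
      proof (rule PiE_ext[of _ "{..<n}" "\<lambda>_. carrier K"])
        show "(\<Oplus>\<^bsub>V\<^esub>i\<in>{..<n}. v i \<odot>\<^bsub>V\<^esub> e i) \<in> {..<n} \<rightarrow>\<^sub>E carrier K"
          using V.finsum_closed[OF ve] by (simp add: carr)
        show "v \<in> {..<n} \<rightarrow>\<^sub>E carrier K" using v by (simp add: carr)
        fix j assume j: "j \<in> {..<n}"
        then have "(\<Oplus>\<^bsub>V\<^esub>i\<in>{..<n}. v i \<odot>\<^bsub>V\<^esub> e i) j = (\<Oplus>i\<in>{..<n}. (v i \<odot>\<^bsub>V\<^esub> e i) j)"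
          using ve by (intro pointwise) auto
        also have "\<dots> = (\<Oplus>i\<in>{..<n}. if j = i then v i else \<zero>)"
          using j v_carr by (intro K.finsum_cong') (auto simp: smult e_def)
        also have "\<dots> = v j"
          using j v_carr by (intro K.finsum_singleton) auto
        finally show "(\<Oplus>\<^bsub>V\<^esub>i\<in>{..<n}. v i \<odot>\<^bsub>V\<^esub> e i) j = v j" .
      qed
      finally show "v \<in> V.span (e ` {..<n})"
        using a by (auto simp: V.span_def intro!: exI[of _ a] exI[of _ "e ` {..<n}"])
    qed
  qed
  then have "V.fin_dim"
    unfolding V.fin_dim_def using e_carr by (intro exI[of _ "e ` {..<n}"]) auto
  then show ?thesis
    unfolding V_def[symmetric] by unfold_locales
qed

end

(* Both kinds of q-g-matroids are convex families: together with A and C they contain every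
   subspace between A and C. In the plane E the family {0, E} is a q-Delta-matroid: since every
   line has a complementary line, alternatives (ii) and (iv) hold whenever (F1) or (F2) has to be
   checked. It omits the lines, so it is not convex. *)
theory Submission
  imports "HOL-Number_Theory.Residues" Defs
begin

context fin_dim_vectorspace
begin

section \<open>Subspaces, their bases and their dimension\<close>

lemma sub_carrier: "sub (carrier V)"
  by (auto simp: subspace_def submodule_def intro: vectorspace_axioms module_axioms)

lemma sub_subset_carrier: "sub A \<Longrightarrow> A \<subseteq> carrier V"
  by (auto simp: subspace_def submodule_def)

lemma sub_span: "S \<subseteq> carrier V \<Longrightarrow> sub (span S)"
  by (rule span_is_subspace)

lemma sub_Int:
  assumes "sub A" "sub B"
  shows "sub (A \<inter> B)"
  using assms by (auto simp: subspace_def submodule_def)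

lemma span_subset: "sub A \<Longrightarrow> S \<subseteq> A \<Longrightarrow> span S \<subseteq> A"
  by (intro span_is_subset) auto

text \<open>Independent subsets of A have at most \<open>dim\<close> elements, so a maximal one
  exists. It spans A, since a vector of A outside its span could be adjoined without losing
  independence.\<close>

lemma sub_basis:
  assumes "sub A"
  obtains B where "finite B" "lin_indpt B" "B \<subseteq> A" "span B = A"
proof -
  have carr: "A \<subseteq> carrier V" by (rule sub_subset_carrier[OF assms])
  have "\<exists>B. finite B \<and> maximal B (\<lambda>B. B \<subseteq> A \<and> lin_indpt B)"
  proof (rule maximal_exists[where B = "{}" and N = dim])
    show "finite B \<and> card B \<le> dim" if "B \<subseteq> A \<and> lin_indpt B" for B
      using li_le_dim[OF fin_dim, of B] that carr by auto
    show "{} \<subseteq> A \<and> lin_indpt {}" by (auto simp: lin_dep_def)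
  qed
  then obtain B where B: "finite B" "B \<subseteq> A" "lin_indpt B"
    and max: "\<And>C. B \<subseteq> C \<Longrightarrow> C \<subseteq> A \<Longrightarrow> lin_indpt C \<Longrightarrow> C = B"
    by (auto simp: maximal_def)
  have "v \<in> span B" if v: "v \<in> A" for v
  proof (rule ccontr)
    assume nv: "v \<notin> span B"
    have "v \<notin> B" using nv B carr in_own_span[of B] by blast
    moreover have "lin_indpt (B \<union> {v})"
      using lin_dep_iff_in_span[of B v] B carr v nv \<open>v \<notin> B\<close> by auto
    ultimately show False using max[of "B \<union> {v}"] B v by auto
  qed
  then have "span B = A" using span_subset[OF assms] B by auto
  with B that show thesis by blast
qed

lemma sdim_eq_card:
  assumes "finite B" "lin_indpt B" "B \<subseteq> carrier V"
  shows "sdim (span B) = card B"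
proof -
  have sub: "sub (span B)" using assms by (intro sub_span)
  have BS: "B \<subseteq> span B" using assms in_own_span by auto
  interpret S: vectorspace K "vs (span B)" by (rule subspace_is_vs[OF sub])
  \<comment> \<open>\<open>span_li_not_depend\<close> identifies span and independence inside the
    subspace structure with those in V, so B is a basis of its own span.\<close>
  have "S.basis B"
    unfolding S.basis_def
    using assms BS span_li_not_depend[OF BS] sub by auto
  then show ?thesis
    unfolding sdim_def using S.dim_basis assms by blast
qed

text \<open>Adjoining v to a basis of A keeps it independent. Later dimension counts rest on this
  single step, adding one vector at a time.\<close>

lemma sdim_sum_span:
  assumes "sub A" "v \<in> carrier V" "v \<notin> A"
  shows "sdim (subspace_sum A (span {v})) = sdim A + 1"
proof -
  obtain B where B: "finite B" "lin_indpt B" "B \<subseteq> A" "span B = A"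
    using sub_basis[OF assms(1)] .
  have carr: "B \<subseteq> carrier V" using B sub_subset_carrier[OF assms(1)] by auto
  have nB: "v \<notin> B" using B assms by auto
  have "lin_indpt (B \<union> {v})"
    using lin_dep_iff_in_span[of B v] B carr assms nB by auto
  then have "sdim (span (B \<union> {v})) = card (B \<union> {v})"
    using B carr assms by (intro sdim_eq_card) auto
  moreover have "span (B \<union> {v}) = subspace_sum A (span {v})"
    using span_union_is_sum[of B "{v}"] B carr assms by auto
  moreover have "sdim A = card B"
    using sdim_eq_card[OF B(1,2) carr] B by simp
  ultimately show ?thesis using B nB by simp
qed

lemma sum_span_subset:
  assumes "sub A" "sub B" "A \<subseteq> B" "v \<in> B"
  shows "subspace_sum A (span {v}) \<subseteq> B"
  using vsum_is_minimal[of A "span {v}" B] span_subset[of B "{v}"] assms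
    sub_span[of "{v}"] sub_subset_carrier[OF assms(2)] by auto

lemma sub_sum_span: "sub A \<Longrightarrow> v \<in> carrier V \<Longrightarrow> sub (subspace_sum A (span {v}))"
  by (intro sum_is_subspace sub_span) auto

text \<open>Descending induction along a chain of subspaces from B to A: the property travels from a
  one-vector extension back down to the smaller space. Monotonicity of dimension and the bound on
  rank growth both use it.\<close>

lemma chain_induct [consumes 3, case_names eq step]:
  assumes "sub A" "sub B" "A \<subseteq> B"
    and eq: "P B"
    and step: "\<And>A v. sub A \<Longrightarrow> A \<subseteq> B \<Longrightarrow> v \<in> B \<Longrightarrow> v \<notin> A \<Longrightarrow>
      P (subspace_sum A (span {v})) \<Longrightarrow> P A"
  shows "P A"
proof -
  \<comment> \<open>The measure \<open>dim - sdim A\<close> is a truncated difference of naturals;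
    only with this bound does it strictly fall when a vector is adjoined.\<close>
  have bound: "sdim A \<le> dim" if A: "sub A" for A
  proof -
    obtain S where "finite S" "lin_indpt S" "S \<subseteq> A" "span S = A" using sub_basis[OF A] .
    then show ?thesis
      using sdim_eq_card[of S] li_le_dim[OF fin_dim, of S] sub_subset_carrier[OF A]
      by auto
  qed
  show ?thesis
    using assms(1,3)
  proof (induction "dim - sdim A" arbitrary: A rule: less_induct)
    case less
    show ?case
    proof (cases "A = B")
      case True
      then show ?thesis using eq by simp
    next
      case False
      then obtain v where v: "v \<in> B" "v \<notin> A" using less.prems by auto
      have vc: "v \<in> carrier V" using v sub_subset_carrier[OF assms(2)] by auto
      let ?A = "subspace_sum A (span {v})"
      have "sub ?A" "?A \<subseteq> B"
        using sub_sum_span[OF less.prems(1) vc] sum_span_subset[OF less.prems(1) assms(2) less.prems(2) v(1)]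
        by auto
      moreover have "dim - sdim ?A < dim - sdim A"
        using bound[OF \<open>sub ?A\<close>] sdim_sum_span[OF less.prems(1) vc v(2)] by simp
      ultimately have "P ?A" by (rule less.hyps[rotated])
      then show ?thesis using step less.prems v by blast
    qed
  qed
qed

lemma sdim_mono:
  assumes "sub A" "sub B" "A \<subseteq> B"
  shows "sdim A \<le> sdim B"
  using assms
proof (induction A rule: chain_induct)
  case (step A v)
  then show ?case
    using sdim_sum_span[of A v] sub_subset_carrier[OF assms(2)] by auto
qed simp

text \<open>A vector of B missing from A would extend A to a subspace of B of dimension larger than
  that of B.\<close>

lemma sub_eqI:
  assumes "sub A" "sub B" "A \<subseteq> B" "sdim B \<le> sdim A"
  shows "A = B"
proof (rule ccontr)
  assume "A \<noteq> B"
  then obtain v where v: "v \<in> B" "v \<notin> A" using assms by auto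
  then have vc: "v \<in> carrier V" using sub_subset_carrier[OF assms(2)] by auto
  have "sdim (subspace_sum A (span {v})) \<le> sdim B"
    using sub_sum_span[OF assms(1) vc] sum_span_subset[OF assms(1-3) v(1)] assms(2)
    by (intro sdim_mono)
  with sdim_sum_span[OF assms(1) vc v(2)] assms(4) show False by simp
qed

lemma sub_zero: "sub {\<zero>\<^bsub>V\<^esub>}"
  using sub_span[of "{}"] by (simp add: span_empty)

lemma zero_subset_sub: "sub A \<Longrightarrow> {\<zero>\<^bsub>V\<^esub>} \<subseteq> A"
  using span_subset[of A "{}"] by (simp add: span_empty)

lemma sdim_zero: "sdim {\<zero>\<^bsub>V\<^esub>} = 0"
  using sdim_eq_card[of "{}"] by (simp add: span_empty lin_dep_def)

lemma line_span:
  assumes "v \<in> carrier V" "v \<noteq> \<zero>\<^bsub>V\<^esub>"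
  shows "line (span {v})"
proof -
  have s: "sub (span {v})" using assms by (intro sub_span) auto
  \<comment> \<open>Seen as an extension of the zero space by v, the span gets dimension 0 + 1 from
    \<open>sdim_sum_span\<close>.\<close>
  have "subspace_sum {\<zero>\<^bsub>V\<^esub>} (span {v}) = span {v}"
    using span_union_is_sum[of "{}" "{v}"] assms by (simp add: span_empty)
  with s sdim_sum_span[OF sub_zero, of v] assms sdim_zero show ?thesis
    by (simp add: line_def)
qed

section \<open>Rank growth, and convexity of both kinds of q-g-matroids\<close>

lemma q_matroid_rank_le:
  assumes "q_matroid r" "sub A" "sub B" "A \<subseteq> B"
  shows "r B \<le> r A + int (sdim B) - int (sdim A)"
  using assms(2-4)
proof (induction A rule: chain_induct)
  case (step A v)
  have vc: "v \<in> carrier V" using step sub_subset_carrier[OF assms(3)] by auto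
  have "v \<noteq> \<zero>\<^bsub>V\<^esub>" using step zero_subset_sub by auto
  then have l: "sub (span {v})" "sdim (span {v}) = 1"
    using line_span[OF vc] by (auto simp: line_def)
  \<comment> \<open>Submodularity for A and a line outside it: the intersection has rank at least 0
    and the line rank at most 1, so one more dimension costs at most one more unit of rank.\<close>
  have "r (subspace_sum A (span {v})) + r (A \<inter> span {v}) \<le> r A + r (span {v})"
    and "0 \<le> r (A \<inter> span {v})" and "r (span {v}) \<le> 1"
    using assms(1) step(1) l(1) sub_Int[OF step(1) l(1)] l(2)[symmetric]
    unfolding q_matroid_def by (blast, blast, metis of_nat_1)
  with step sdim_sum_span[OF step(1) vc step(4)] show ?case by simp
qed simp

text \<open>Rank grows by at most one per dimension, so a deficit of rank in A could never be made
  up on the way to B.\<close>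

lemma q_independent_subset:
  assumes "q_matroid r" "q_independent r B" "sub A" "A \<subseteq> B"
  shows "q_independent r A"
proof -
  have "r A \<le> int (sdim A)" using assms by (auto simp: q_matroid_def)
  with q_matroid_rank_le[of r A B] assms show ?thesis by (auto simp: q_independent_def)
qed

lemma q_spanning_superset:
  assumes "q_matroid r" "q_spanning r A" "sub B" "A \<subseteq> B"
  shows "q_spanning r B"
proof -
  have "r A \<le> r B" "r B \<le> r (carrier V)"
    using assms sub_carrier sub_subset_carrier[of B] unfolding q_matroid_def q_spanning_def by blast+
  with assms show ?thesis by (auto simp: q_spanning_def)
qed

text \<open>Independence in \<open>r1\<close> descends from C to B, and spanning in
  \<open>r2\<close> ascends from A to B.\<close>

lemma q_g_matroid_convex:
  assumes "q_g_matroid \<F>" "A \<in> \<F>" "C \<in> \<F>" "sub B" "A \<subseteq> B" "B \<subseteq> C"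
  shows "B \<in> \<F>"
proof -
  obtain r1 r2 where r: "q_matroid r1" "q_matroid r2"
    and F: "\<F> = {A. sub A \<and> q_independent r1 A \<and> q_spanning r2 A}"
    using assms(1) unfolding q_g_matroid_def by auto
  have "q_independent r1 B" using q_independent_subset[OF r(1) _ assms(4,6)] assms(3) F by auto
  moreover have "q_spanning r2 B" using q_spanning_superset[OF r(2) _ assms(4,5)] assms(2) F by auto
  ultimately show ?thesis using assms(4) F by auto
qed

text \<open>The basis of \<open>r2\<close> below A and the basis of \<open>r1\<close> above C also
  enclose B.\<close>

lemma weak_q_g_matroid_convex:
  assumes "weak_q_g_matroid \<F>" "A \<in> \<F>" "C \<in> \<F>" "sub B" "A \<subseteq> B" "B \<subseteq> C"
  shows "B \<in> \<F>"
proof -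
  obtain r1 r2 where
    F: "\<F> = {A. sub A \<and> (\<exists>B2 B1. q_basis r2 B2 \<and> q_basis r1 B1 \<and> B2 \<subseteq> A \<and> A \<subseteq> B1)}"
    using assms(1) unfolding weak_q_g_matroid_def by auto
  obtain B2 where "q_basis r2 B2" "B2 \<subseteq> A" using assms(2) F by auto
  moreover obtain B1 where "q_basis r1 B1" "C \<subseteq> B1" using assms(3) F by auto
  ultimately show ?thesis using assms(4-6) unfolding F by blast
qed

section \<open>The family consisting of the zero space and the whole plane\<close>

lemma complementary_line:
  assumes dim2: "sdim (carrier V) = 2" and A: "line A"
  obtains Z where "line Z" "Z \<inter> A = {\<zero>\<^bsub>V\<^esub>}" "subspace_sum A Z = carrier V"
proof -
  have sA: "sub A" "sdim A = 1" using A by (auto simp: line_def)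
  then have "A \<noteq> carrier V" using dim2 by auto
  \<comment> \<open>Any vector off A spans a complement: its line meets A in a proper subspace of
    that line, hence in dimension 0, and adjoining it raises the dimension of A from 1 to 2.\<close>
  then obtain v where v: "v \<in> carrier V" "v \<notin> A" using sub_subset_carrier[OF sA(1)] by auto
  then have Z: "line (span {v})" using line_span zero_subset_sub[OF sA(1)] by auto
  then have sZ: "sub (span {v})" "sdim (span {v}) = 1" by (auto simp: line_def)
  have sI: "sub (span {v} \<inter> A)" using sub_Int sZ sA by blast
  have "sdim (span {v} \<inter> A) = 0"
  proof (rule ccontr)
    assume "sdim (span {v} \<inter> A) \<noteq> 0"
    then have "span {v} \<inter> A = span {v}" using sI sZ by (intro sub_eqI) auto
    moreover have "v \<in> span {v}" by (rule span_self[OF v(1)])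
    ultimately show False using v by auto
  qed
  then have "{\<zero>\<^bsub>V\<^esub>} = span {v} \<inter> A"
    using sub_zero sI zero_subset_sub[OF sI] by (intro sub_eqI) auto
  moreover have "subspace_sum A (span {v}) = carrier V"
    using sub_sum_span[OF sA(1) v(1)] sub_carrier sub_subset_carrier
      sdim_sum_span[OF sA(1) v] sA dim2 by (intro sub_eqI) auto
  ultimately show thesis using that Z by auto
qed

lemma line_exists:
  assumes "0 < sdim (carrier V)"
  obtains L where "line L"
proof -
  have "carrier V \<noteq> {\<zero>\<^bsub>V\<^esub>}" using assms sdim_zero by auto
  then obtain v where "v \<in> carrier V" "v \<noteq> \<zero>\<^bsub>V\<^esub>" using zero_subset_sub[OF sub_carrier] by auto
  with line_span that show thesis by blast
qed

lemma codim1_zero_iff: "codim1 {\<zero>\<^bsub>V\<^esub>} A \<longleftrightarrow> line A"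
  using sub_zero zero_subset_sub sdim_zero by (auto simp: codim1_def line_def)

lemma not_codim1_zero: "\<not> codim1 A {\<zero>\<^bsub>V\<^esub>}"
  using sdim_zero by (auto simp: codim1_def)

lemma not_codim1_carrier: "\<not> codim1 (carrier V) A"
proof
  assume "codim1 (carrier V) A"
  moreover from this have "A = carrier V" using sub_subset_carrier by (auto simp: codim1_def)
  ultimately show False by (simp add: codim1_def)
qed

lemma codim1_carrier_iff:
  assumes "sdim (carrier V) = 2"
  shows "codim1 A (carrier V) \<longleftrightarrow> line A"
  using assms sub_carrier sub_subset_carrier by (auto simp: codim1_def line_def)

lemma q_delta_matroid_plane:
  assumes "sdim (carrier V) = 2"
  shows "q_delta_matroid {{\<zero>\<^bsub>V\<^esub>}, carrier V}"
  unfolding q_delta_matroid_def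
proof (intro conjI)
  show "F1 {{\<zero>\<^bsub>V\<^esub>}, carrier V}"
    unfolding F1_def
  proof (intro ballI allI impI disjI2)
    fix X A assume "X \<in> {{\<zero>\<^bsub>V\<^esub>}, carrier V}" "codim1 A X"
    \<comment> \<open>The zero space contains nothing of codimension 1, so X is the plane and A a
      line. Lines and hyperplanes coincide here, so a complementary line is a legitimate Z.\<close>
    then have "line A" using not_codim1_zero codim1_carrier_iff[OF assms] by auto
    then obtain Z where "line Z" "Z \<inter> A = {\<zero>\<^bsub>V\<^esub>}"
      using complementary_line[OF assms] by metis
    then show "\<exists>Z. codim1 Z (carrier V) \<and> Z \<inter> A \<in> {{\<zero>\<^bsub>V\<^esub>}, carrier V}"
      using codim1_carrier_iff[OF assms] by (intro exI[of _ Z]) simp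
  qed
  show "F2 {{\<zero>\<^bsub>V\<^esub>}, carrier V}"
    unfolding F2_def
  proof (intro ballI allI impI disjI2)
    fix X A assume "X \<in> {{\<zero>\<^bsub>V\<^esub>}, carrier V}" "codim1 X A"
    \<comment> \<open>Dually, nothing lies properly above the plane, so X is the zero space and A
      again a line.\<close>
    then have "line A" using not_codim1_carrier codim1_zero_iff by auto
    then obtain z where "line z" "subspace_sum A z = carrier V"
      using complementary_line[OF assms] by metis
    then show "\<exists>z. line z \<and> subspace_sum A z \<in> {{\<zero>\<^bsub>V\<^esub>}, carrier V}"
      by (intro exI[of _ z]) simp
  qed
qed (use sub_zero sub_carrier in auto)

lemma not_convex_plane:
  assumes "sdim (carrier V) = 2"
  obtains L where "sub L" "{\<zero>\<^bsub>V\<^esub>} \<subseteq> L" "L \<subseteq> carrier V" "L \<notin> {{\<zero>\<^bsub>V\<^esub>}, carrier V}"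
proof -
  obtain L where L: "line L" using line_exists assms by auto
  then have "sub L" "L \<noteq> {\<zero>\<^bsub>V\<^esub>}" "L \<noteq> carrier V"
    using assms sdim_zero by (auto simp: line_def)
  with zero_subset_sub[of L] sub_subset_carrier[of L] that[of L] show thesis by simp
qed

end

section \<open>The dimension of the coordinate space\<close>

lemma sdim_coord_space:
  fixes K (structure)
  assumes "field K"
  shows "fin_dim_vectorspace.sdim K (coord_space K n) (carrier (coord_space K n)) = n"
proof -
  interpret K: field K by fact
  define V where "V = coord_space K n"
  interpret V: fin_dim_vectorspace K V
    unfolding V_def by (rule fin_dim_vectorspace_coord_space[OF assms])
  have carr: "carrier V = {..<n} \<rightarrow>\<^sub>E carrier K"
    and add: "f \<oplus>\<^bsub>V\<^esub> g = (\<lambda>j\<in>{..<n}. f j \<oplus> g j)"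
    and zero: "\<zero>\<^bsub>V\<^esub> = (\<lambda>j\<in>{..<n}. \<zero>)"
    and smult: "c \<odot>\<^bsub>V\<^esub> f = (\<lambda>j\<in>{..<n}. c \<otimes> f j)" for f g c
    by (simp_all add: V_def K.func_space_def)
  define e where "e i = (\<lambda>j\<in>{..<n}. if j = i then \<one> else \<zero>)" for i
  \<comment> \<open>The standard flag: \<open>W i\<close> consists of the vectors supported on the
    first i coordinates. Each stage adjoins \<open>e i\<close> to the previous one, so the dimension
    can be counted by \<open>sdim_sum_span\<close>.\<close>
  define W where "W i = {f \<in> carrier V. \<forall>j<n. i \<le> j \<longrightarrow> f j = \<zero>}" for i
  have e: "e i \<in> carrier V" for i by (auto simp: carr e_def)
  have W: "V.sub (W i)" for i
    unfolding subspace_def submodule_def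
    by (auto simp: W_def add zero smult carr intro: V.vectorspace_axioms V.module_axioms)
  have W_Suc: "W (Suc i) = V.subspace_sum (W i) (V.span {e i})" if i: "i < n" for i
  proof
    show "V.subspace_sum (W i) (V.span {e i}) \<subseteq> W (Suc i)"
      using W e i by (intro V.sum_span_subset) (auto simp: W_def e_def)
    show "W (Suc i) \<subseteq> V.subspace_sum (W i) (V.span {e i})"
    proof
      fix f assume f: "f \<in> W (Suc i)"
      then have fK: "f j \<in> carrier K" if "j < n" for j
        using that by (auto simp: W_def carr)
      \<comment> \<open>Clearing coordinate i of f leaves a vector of \<open>W i\<close>; the
        removed part is the multiple \<open>f i\<close> of \<open>e i\<close>.\<close>
      define g where "g = (\<lambda>j\<in>{..<n}. if j = i then \<zero> else f j)"
      have "g \<in> W i" using f by (auto simp: W_def g_def carr)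
      moreover have "f i \<odot>\<^bsub>V\<^esub> e i \<in> V.span {e i}"
        using V.span_self[OF e] V.sub_span[of "{e i}"] e fK[OF i]
        by (auto simp: subspace_def submodule_def)
      moreover have "f = g \<oplus>\<^bsub>V\<^esub> f i \<odot>\<^bsub>V\<^esub> e i"
      proof (rule PiE_ext[of _ "{..<n}" "\<lambda>_. carrier K"])
        show "f \<in> {..<n} \<rightarrow>\<^sub>E carrier K" using f by (auto simp: W_def carr)
        show "g \<oplus>\<^bsub>V\<^esub> f i \<odot>\<^bsub>V\<^esub> e i \<in> {..<n} \<rightarrow>\<^sub>E carrier K"
          using fK i by (auto simp: add smult g_def e_def)
        show "f j = (g \<oplus>\<^bsub>V\<^esub> f i \<odot>\<^bsub>V\<^esub> e i) j" if "j \<in> {..<n}" for j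
          using that fK i by (auto simp: add smult g_def e_def)
      qed
      ultimately show "f \<in> V.subspace_sum (W i) (V.span {e i})"
        unfolding V.submodule_sum_def
        by (intro image_eqI[where x = "(g, f i \<odot>\<^bsub>V\<^esub> e i)"]) simp_all
    qed
  qed
  \<comment> \<open>The restriction to i at most n is essential: from n on the flag stays at the
    whole space.\<close>
  have sdim_W: "V.sdim (W i) = i" if "i \<le> n" for i
    using that
  proof (induction i)
    case 0
    have "W 0 = {\<zero>\<^bsub>V\<^esub>}"
      \<comment> \<open>Members of the carrier are \<open>undefined\<close> off
        \<open>{..<n}\<close>, so vanishing coordinates determine the zero vector.\<close>
      by (auto simp: W_def carr zero PiE_iff extensional_def fun_eq_iff)
    then show ?case by (simp add: V.sdim_zero)
  next
    case (Suc i)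
    have "e i \<notin> W i" using Suc.prems by (auto simp: W_def e_def intro!: exI[of _ i])
    with V.sdim_sum_span[OF W e] Suc W_Suc show ?case by simp
  qed
  have "W n = carrier V" by (auto simp: W_def)
  with sdim_W[of n] show ?thesis by (simp add: V_def)
qed

theorem proposition4p7:
  shows "\<exists>(K :: int ring) (n :: nat) (\<F> :: (nat \<Rightarrow> int) set set).
    field K \<and>
    fin_dim_vectorspace.q_delta_matroid K (coord_space K n) \<F> \<and>
    \<not> fin_dim_vectorspace.weak_q_g_matroid K (coord_space K n) \<F> \<and>
    \<not> fin_dim_vectorspace.q_g_matroid K (coord_space K n) \<F>"
proof -
  \<comment> \<open>The field with two elements, realised on integers to fit the type
    \<open>int ring\<close>. The plane argument applies over any field.\<close>
  define K where "K = residue_ring 2"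
  interpret R: residues_prime 2 K
    by unfold_locales (auto simp: K_def)
  have K: "field K" by (rule R.is_field)
  define V where "V = coord_space K 2"
  interpret V: fin_dim_vectorspace K V
    unfolding V_def by (rule fin_dim_vectorspace_coord_space[OF K])
  let ?F = "{{\<zero>\<^bsub>V\<^esub>}, carrier V}"
  have dim2: "V.sdim (carrier V) = 2"
    unfolding V_def by (rule sdim_coord_space[OF K])
  obtain L where L: "V.sub L" "{\<zero>\<^bsub>V\<^esub>} \<subseteq> L" "L \<subseteq> carrier V" "L \<notin> ?F"
    using V.not_convex_plane[OF dim2] .
  \<comment> \<open>Both end members of the family enclose L, so convexity would force L into
    it.\<close>
  have "\<not> V.weak_q_g_matroid ?F"
    using V.weak_q_g_matroid_convex[OF _ _ _ L(1-3), of ?F] L(4) by blast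
  moreover have "\<not> V.q_g_matroid ?F"
    using V.q_g_matroid_convex[OF _ _ _ L(1-3), of ?F] L(4) by blast
  ultimately show ?thesis
    using K V.q_delta_matroid_plane[OF dim2] unfolding V_def by blast
qed

end
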